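(* Let $n>3$ be odd. The class $\langle L_n\cup I\rangle$ does not contain any associative neutrosophic loop; that is, for every positive integer $m<n$ with $\gcd(m,n)=\gcd(m-1,n)=1$, the operation of $\langle L_n(m)\cup I\rangle$ is not associative.
   Context: For $n>3$ odd and $m<n$ a positive integer with $\gcd(m,n)=\gcd(m-1,n)=1$, the loop $L_n(m)$ is the set $\{e,1,2,\dots,n\}$ with operation: $e\cdot i=i\cdot e=i$ for all $i$; $i\cdot i=e$ for all $i$; and for $i,j\in\{1,\dots,n\}$, $i\neq j$, $i\cdot j$ is the element $s\in\{1,\dots,n\}$ with $s\equiv mj-(m-1)i \pmod n$. The neutrosophic loop $\langle L_n(m)\cup I\rangle$ is the set $\{e,1,\dots,n,eI,1I,\dots,nI\}$ of $2(n+1)$ distinct symbols, with the product of $L_n(m)$ on $\{e,1,\dots,n\}$ and $x\cdot(yI)=(xI)\cdot y=(xI)\cdot(yI)=(x\cdot y)I$ for $x,y\in L_n(m)$. $\langle L_n\cup I\rangle$ denotes the collection of all such $\langle L_n(m)\cup I\rangle$ for fixed $n$. *)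

theory Defs
  imports "HOL-Algebra.Group" "HOL-Number_Theory.Cong"
begin

datatype lelem = E | Num nat

text \<open>Products of numbers are taken over the integers, since \<open>m j - (m - 1) i\<close> may be
  negative. The definite description is well defined for \<open>n > 0\<close>; see \<open>loop_residue_unique\<close>.\<close>

definition loop_residue :: "nat \<Rightarrow> nat \<Rightarrow> nat \<Rightarrow> nat \<Rightarrow> nat" where
  "loop_residue n m i j =
     (THE s. s \<in> {1..n} \<and> [int s = int m * int j - (int m - 1) * int i] (mod int n))"

fun loop_mult :: "nat \<Rightarrow> nat \<Rightarrow> lelem \<Rightarrow> lelem \<Rightarrow> lelem" where
  "loop_mult n m E y = y"
| "loop_mult n m x E = x"
| "loop_mult n m (Num i) (Num j) = (if i = j then E else Num (loop_residue n m i j))"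

text \<open>The record type \<open>monoid\<close> only bundles a carrier, a product and a unit; it does not
  assume associativity.\<close>

definition L_loop :: "nat \<Rightarrow> nat \<Rightarrow> lelem monoid" where
  "L_loop n m = \<lparr>carrier = insert E (Num ` {1..n}), monoid.mult = loop_mult n m, one = E\<rparr>"

text \<open>\<open>Plain x\<close> stands for the element \<open>x\<close> and \<open>Indet x\<close> for the formal symbol \<open>xI\<close>.\<close>

datatype 'a neutro = Plain 'a | Indet 'a

fun neutro_mult :: "('a \<Rightarrow> 'a \<Rightarrow> 'a) \<Rightarrow> 'a neutro \<Rightarrow> 'a neutro \<Rightarrow> 'a neutro" where
  "neutro_mult f (Plain x) (Plain y) = Plain (f x y)"
| "neutro_mult f (Plain x) (Indet y) = Indet (f x y)"
| "neutro_mult f (Indet x) (Plain y) = Indet (f x y)"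
| "neutro_mult f (Indet x) (Indet y) = Indet (f x y)"

definition neutrosophic :: "'a monoid \<Rightarrow> 'a neutro monoid" where
  "neutrosophic L =
     \<lparr>carrier = Plain ` carrier L \<union> Indet ` carrier L,
      monoid.mult = neutro_mult (monoid.mult L),
      one = Plain (one L)\<rparr>"

definition neutrosophic_class :: "nat \<Rightarrow> lelem neutro monoid set" where
  "neutrosophic_class n =
     {neutrosophic (L_loop n m) | m. 0 < m \<and> m < n \<and> gcd m n = 1 \<and> gcd (m - 1) n = 1}"

definition associative :: "'a monoid \<Rightarrow> bool" where
  "associative G \<longleftrightarrow>
     (\<forall>x\<in>carrier G. \<forall>y\<in>carrier G. \<forall>z\<in>carrier G.
        (x \<otimes>\<^bsub>G\<^esub> y) \<otimes>\<^bsub>G\<^esub> z = x \<otimes>\<^bsub>G\<^esub> (y \<otimes>\<^bsub>G\<^esub> z))"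

lemma loop_residue_unique:
  assumes "n > 0"
  shows "\<exists>!s::nat. s \<in> {1..n} \<and> [int s = a] (mod int n)"
proof (rule ex_ex1I)
  define r where "r = nat (a mod int n)"
  have r: "int r = a mod int n" using assms by (simp add: r_def)
  have rn: "r < n" using assms r by (metis of_nat_0_less_iff of_nat_less_iff pos_mod_bound)
  define s where "s = (if r = 0 then n else r)"
  have "s \<in> {1..n}" using assms rn by (auto simp: s_def)
  moreover have "[int s = a] (mod int n)"
    using r by (auto simp: s_def cong_def)
  ultimately show "\<exists>s::nat. s \<in> {1..n} \<and> [int s = a] (mod int n)" by blast
next
  fix s t :: nat
  assume s: "s \<in> {1..n} \<and> [int s = a] (mod int n)"
    and t: "t \<in> {1..n} \<and> [int t = a] (mod int n)"
  then have "[int s = int t] (mod int n)" by (meson cong_sym cong_trans)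
  then have "int n dvd int s - int t" by (simp add: cong_iff_dvd_diff)
  moreover have "\<bar>int s - int t\<bar> < int n" using s t by auto
  ultimately have "int s - int t = 0" by (metis dvd_imp_le_int not_less abs_of_nat)
  then show "s = t" by simp
qed

lemma loop_residue:
  assumes "n > 0"
  shows "loop_residue n m i j \<in> {1..n}"
    and "[int (loop_residue n m i j) = int m * int j - (int m - 1) * int i] (mod int n)"
  using theI'[OF loop_residue_unique[OF assms, of "int m * int j - (int m - 1) * int i"]]
  unfolding loop_residue_def by blast+

lemma L_loop_closed:
  assumes "x \<in> carrier (L_loop n m)" "y \<in> carrier (L_loop n m)"
  shows "x \<otimes>\<^bsub>L_loop n m\<^esub> y \<in> carrier (L_loop n m)"
proof -
  have "Num (loop_residue n m i j) \<in> Num ` {1..n}" if "i \<in> {1..n}" for i j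
    using loop_residue(1)[of n m i j] that by auto
  then show ?thesis using assms by (auto simp: L_loop_def split: if_splits)
qed

lemma neutrosophic_closed:
  assumes "x \<in> carrier (neutrosophic (L_loop n m))" "y \<in> carrier (neutrosophic (L_loop n m))"
  shows "x \<otimes>\<^bsub>neutrosophic (L_loop n m)\<^esub> y \<in> carrier (neutrosophic (L_loop n m))"
  using assms L_loop_closed[of _ n m] by (auto simp: neutrosophic_def)

lemma card_neutrosophic_L_loop: "card (carrier (neutrosophic (L_loop n m))) = 2 * (n + 1)"
proof -
  have c: "card (carrier (L_loop n m)) = n + 1" and f: "finite (carrier (L_loop n m))"
    by (auto simp: L_loop_def card_insert_if card_image inj_on_def)
  show ?thesis
    unfolding neutrosophic_def using c f
    by (simp, subst card_Un_disjoint) (auto simp: card_image inj_on_def)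
qed

end

theory Submission
  imports Defs
begin

text \<open>
  In an associative loop whose elements all square to the identity,
  \<open>x (x y) = (x x) y = y\<close> and \<open>(x y) y = x (y y) = x\<close>.
  Applied to \<open>x = 1\<close> and \<open>y = 2\<close> in \<open>L\<^sub>n(m)\<close>, where \<open>x y \<equiv> m + 1\<close>, the first identity
  says \<open>m\<^sup>2 \<equiv> 1\<close> and the second says \<open>m (m - 2) \<equiv> 0\<close>, that is \<open>m \<equiv> 2\<close> since \<open>m\<close> is
  a unit modulo \<open>n\<close>. Together they give \<open>4 \<equiv> 1\<close> modulo \<open>n\<close>, so \<open>n\<close> divides \<open>3\<close>, which
  contradicts \<open>n > 3\<close>. The coprimality of \<open>m\<close> and of \<open>m - 1\<close> with \<open>n\<close> ensures that
  \<open>x y\<close> is neither \<open>x\<close> nor \<open>y\<close>, so that all these products follow the congruence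
  rule. Finally, \<open>L\<^sub>n(m)\<close> sits inside its neutrosophic loop as the set of plain elements,
  so an associative neutrosophic loop would make \<open>L\<^sub>n(m)\<close> associative.
\<close>

lemma associative_if_associative_neutrosophic:
  assumes "associative (neutrosophic L)"
  shows "associative L"
  using assms by (force simp: associative_def neutrosophic_def)

text \<open>
  Only the products of \<open>1\<close>, \<open>2\<close> and \<open>1 2\<close> are needed: already the subloop that \<open>1\<close>
  and \<open>2\<close> generate violates one of the two cancellation identities.
\<close>

lemma not_associative_L_loop:
  assumes n: "n > 3" and m: "0 < m" and "gcd m n = 1" and "gcd (m - 1) n = 1"
  shows "\<not> associative (L_loop n m)"
proof
  assume assoc: "associative (L_loop n m)"
  have coprime_m: "coprime (int n) (int m)"
    using \<open>gcd m n = 1\<close> by (metis coprime_iff_gcd_eq_1 coprime_commute coprime_int_iff)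
  have coprime_m1: "coprime (int n) (int m - 1)"
  proof -
    have "coprime (int n) (int (m - 1))"
      using \<open>gcd (m - 1) n = 1\<close> by (metis coprime_iff_gcd_eq_1 coprime_commute coprime_int_iff)
    then show ?thesis using m by (simp add: of_nat_diff)
  qed
  define k where "k = loop_residue n m 1 2"
  have k_range: "k \<in> {1..n}"
    using loop_residue(1) n unfolding k_def by simp
  have "[int k = int m * int 2 - (int m - 1) * int 1] (mod int n)"
    unfolding k_def using n by (intro loop_residue(2)) simp
  then have k_cong: "int n dvd int k - (int m + 1)"
    by (simp add: cong_iff_dvd_diff algebra_simps)
  have k_neq_1: "k \<noteq> 1"
  proof
    assume "k = 1"
    then have "int n dvd int m" using k_cong by simp
    then have "is_unit (int n)" using coprime_m by (meson coprime_common_divisor dvd_refl)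
    then show False using n by simp
  qed
  have k_neq_2: "k \<noteq> 2"
  proof
    assume "k = 2"
    then have "int n dvd - (int m - 1)" using k_cong by simp
    then have "int n dvd int m - 1" by (simp only: dvd_minus_iff)
    then have "is_unit (int n)" using coprime_m1 by (meson coprime_common_divisor dvd_refl)
    then show False using n by simp
  qed

  have law: "loop_mult n m (loop_mult n m (Num i) (Num j)) (Num l)
           = loop_mult n m (Num i) (loop_mult n m (Num j) (Num l))"
    if "i \<in> {1..n}" "j \<in> {1..n}" "l \<in> {1..n}" for i j l
    using assoc that unfolding associative_def L_loop_def by simp
  \<comment> \<open>With the product \<open>1 2 = k\<close>: \<open>1 k = 1 (1 2) = 2\<close> and \<open>k 2 = (1 2) 2 = 1\<close>.\<close>
  have res_1k: "loop_residue n m 1 k = 2"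
    using law[of 1 1 2] n k_neq_1 by (simp add: k_def)
  have res_k2: "loop_residue n m k 2 = 1"
    using law[of 1 2 2] n k_neq_2 by (simp add: k_def)

  have "[int 2 = int m * int k - (int m - 1) * int 1] (mod int n)"
    using loop_residue(2)[of n m 1 k] n unfolding res_1k by simp
  then have "int n dvd 2 - (int m * int k - (int m - 1))"
    by (simp add: cong_iff_dvd_diff)
  \<comment> \<open>The multiple of \<open>k - (m + 1)\<close> replaces \<open>k\<close> by \<open>m + 1\<close>; likewise for the second identity.\<close>
  then have "int n dvd (2 - (int m * int k - (int m - 1))) + int m * (int k - (int m + 1))"
    using dvd_mult[OF k_cong] by (rule dvd_add)
  then have m_square: "int n dvd 1 - int m * int m"
    by (simp add: algebra_simps)

  have "[int 1 = int m * int 2 - (int m - 1) * int k] (mod int n)"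
    using loop_residue(2)[of n m k 2] n unfolding res_k2 by simp
  then have "int n dvd 1 - (int m * 2 - (int m - 1) * int k)"
    by (simp add: cong_iff_dvd_diff)
  then have "int n dvd (1 - (int m * 2 - (int m - 1) * int k))
                       - (int m - 1) * (int k - (int m + 1))"
    using dvd_mult[OF k_cong] by (rule dvd_diff)
  then have "int n dvd int m * (int m - 2)"
    by (simp add: algebra_simps)
  then have m_two: "int n dvd int m - 2"
    using coprime_m by (simp add: coprime_dvd_mult_right_iff)

  \<comment> \<open>\<open>(m + 2) (m - 2) = m\<^sup>2 - 4\<close>, so the powers of \<open>m\<close> cancel.\<close>
  have "int n dvd (1 - int m * int m) + (int m + 2) * (int m - 2)"
    using m_square m_two by (intro dvd_add dvd_mult)
  then have "int n dvd - 3"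
    by (simp add: algebra_simps)
  then have "int n dvd 3"
    by (simp only: dvd_minus_iff)
  then show False
    using n by (auto dest: zdvd_imp_le)
qed

theorem theorem4p1p14:
  fixes n :: nat
  assumes "n > 3" and "odd n"
  shows "\<not> (\<exists>G \<in> neutrosophic_class n. associative G)"
proof
  assume "\<exists>G \<in> neutrosophic_class n. associative G"
  then obtain m where m: "0 < m" "gcd m n = 1" "gcd (m - 1) n = 1"
    and assoc: "associative (neutrosophic (L_loop n m))"
    unfolding neutrosophic_class_def by auto
  from assoc have "associative (L_loop n m)"
    by (rule associative_if_associative_neutrosophic)
  then show False
    using not_associative_L_loop[OF \<open>n > 3\<close> m] by contradiction
qed

end
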